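(* Let $A,B,C,D\in\mathbb{C}^{n\times n}$ be such that $A$, $D$, $BC$ and $CB$ are *-DMP, and let $M=\begin{pmatrix}A&B\\ C&D\end{pmatrix}\in\mathbb{C}^{2n\times 2n}$. If $AB=BD$, $DC=CA$, $A^*B=BD^*$, $D^*C=CA^*$ and $A^DBD^DC$ is nilpotent, then $M$ is *-DMP.
   Context: $\mathbb{C}^{k\times k}$ is the Banach *-algebra of $k\times k$ complex matrices with conjugate transpose $X^*$ as involution. The Drazin inverse $X^D$ of a matrix $X$ is the unique matrix $Y$ with $YX^{k+1}=X^k$ for some $k$, $XY^2=Y$, $XY=YX$ (the superscript $D$ denotes the Drazin inverse, not the block $D$). A matrix $X$ is *-DMP if there is a positive integer $r$ such that $X^r$ has a Moore-Penrose inverse and a group inverse and $(X^r)^{\dag}=(X^r)^{\#}$ (here $Z^{\dag}$ is the $Y$ with $ZYZ=Z$, $YZY=Y$, $(ZY)^*=ZY$, $(YZ)^*=YZ$, and $Z^{\#}$ is the $Y$ with $ZYZ=Z$, $YZY=Y$, $ZY=YZ$). *)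

theory Defs
  imports "Jordan_Normal_Form.Schur_Decomposition"
begin

definition is_drazin_inverse :: "complex mat \<Rightarrow> complex mat \<Rightarrow> bool" where
  "is_drazin_inverse X Y \<longleftrightarrow>
     square_mat X \<and> Y \<in> carrier_mat (dim_row X) (dim_row X) \<and>
     (\<exists>k. Y * X ^\<^sub>m (k + 1) = X ^\<^sub>m k) \<and> X * (Y * Y) = Y \<and> X * Y = Y * X"

definition is_moore_penrose_inverse :: "complex mat \<Rightarrow> complex mat \<Rightarrow> bool" where
  "is_moore_penrose_inverse Z Y \<longleftrightarrow>
     Y \<in> carrier_mat (dim_col Z) (dim_row Z) \<and>
     Z * Y * Z = Z \<and> Y * Z * Y = Y \<and>
     mat_adjoint (Z * Y) = Z * Y \<and> mat_adjoint (Y * Z) = Y * Z"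

definition is_group_inverse :: "complex mat \<Rightarrow> complex mat \<Rightarrow> bool" where
  "is_group_inverse Z Y \<longleftrightarrow>
     square_mat Z \<and> Y \<in> carrier_mat (dim_row Z) (dim_row Z) \<and>
     Z * Y * Z = Z \<and> Y * Z * Y = Y \<and> Z * Y = Y * Z"

text \<open>Each of the three inverses is unique when it exists; see the lemmas below.
  Their values are unspecified for matrices that do not have the inverse in question.\<close>

definition drazin_inverse :: "complex mat \<Rightarrow> complex mat" where
  "drazin_inverse X = (THE Y. is_drazin_inverse X Y)"

definition moore_penrose_inverse :: "complex mat \<Rightarrow> complex mat" where
  "moore_penrose_inverse Z = (THE Y. is_moore_penrose_inverse Z Y)"

definition group_inverse :: "complex mat \<Rightarrow> complex mat" where
  "group_inverse Z = (THE Y. is_group_inverse Z Y)"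

definition star_dmp :: "complex mat \<Rightarrow> bool" where
  "star_dmp X \<longleftrightarrow> square_mat X \<and>
     (\<exists>r>0. (\<exists>Y. is_moore_penrose_inverse (X ^\<^sub>m r) Y) \<and> (\<exists>Y. is_group_inverse (X ^\<^sub>m r) Y) \<and>
            moore_penrose_inverse (X ^\<^sub>m r) = group_inverse (X ^\<^sub>m r))"

definition nilpotent_mat :: "complex mat \<Rightarrow> bool" where
  "nilpotent_mat X \<longleftrightarrow> square_mat X \<and> (\<exists>m. X ^\<^sub>m m = 0\<^sub>m (dim_row X) (dim_row X))"

lemma (in monoid) drazin_unique_aux:
  assumes c: "x \<in> carrier G" "y \<in> carrier G" "z \<in> carrier G"
    and y: "y \<otimes> x [^] Suc k = x [^] k" "x \<otimes> (y \<otimes> y) = y" "x \<otimes> y = y \<otimes> x"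
    and z: "z \<otimes> x [^] Suc l = x [^] l" "x \<otimes> (z \<otimes> z) = z" "x \<otimes> z = z \<otimes> x"
  shows "y = z"
proof -
  note nat_pow_Suc [simp del]
  have absorb: "(w \<otimes> x) \<otimes> x [^] (j + i) = x [^] (j + i)"
    if w: "w \<in> carrier G" "w \<otimes> x [^] Suc j = x [^] j" for w and i j :: nat
  proof -
    have "(w \<otimes> x) \<otimes> x [^] (j + i) = w \<otimes> (x \<otimes> x [^] j) \<otimes> x [^] i"
      using c w(1) by (simp add: m_assoc nat_pow_mult [symmetric])
    also have "x \<otimes> x [^] j = x [^] Suc j"
      using nat_pow_Suc2 c by simp
    finally show ?thesis using c w by (simp add: nat_pow_mult)
  qed
  have pw: "(w \<otimes> x) [^] Suc i = w \<otimes> x"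
    if w: "w \<in> carrier G" "x \<otimes> (w \<otimes> w) = w" "x \<otimes> w = w \<otimes> x" for w and i :: nat
  proof -
    have "(w \<otimes> x) \<otimes> (w \<otimes> x) = (x \<otimes> w) \<otimes> (w \<otimes> x)" using w(3) by simp
    also have "\<dots> = (x \<otimes> (w \<otimes> w)) \<otimes> x" using c w(1) by (simp add: m_assoc)
    finally have "(w \<otimes> x) \<otimes> (w \<otimes> x) = w \<otimes> x" using w(2) by simp
    then show ?thesis using c w(1) by (induction i) (simp_all add: nat_pow_Suc)
  qed
  define p where "p = x [^] Suc (k + l)"
  define q where "q = y [^] Suc (k + l)"
  define r where "r = z [^] Suc (k + l)"
  have pqr: "p \<in> carrier G" "q \<in> carrier G" "r \<in> carrier G"
    using c by (auto simp: p_def q_def r_def)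
  have ym: "(y \<otimes> x) \<otimes> p = p"
    using absorb[of y k "Suc l"] c y by (simp add: p_def)
  have zm: "(z \<otimes> x) \<otimes> p = p"
    using absorb[of z l "Suc k"] c z by (simp add: p_def add.commute)
  have "x \<otimes> (z \<otimes> x) = (z \<otimes> x) \<otimes> x"
    using c z(3) m_assoc[of x z x] by simp
  then have zc: "p \<otimes> (z \<otimes> x) = p"
    using zm c group_commutes_pow[of x "z \<otimes> x" "Suc (k + l)"] by (simp add: p_def)
  have yx: "y \<otimes> x = q \<otimes> p"
    using pw[OF c(2) y(2,3), of "k + l"] pow_mult_distrib[of y x "Suc (k + l)"] y(3) c
    by (simp add: p_def q_def)
  have zx: "z \<otimes> x = p \<otimes> r"
    using pw[OF c(3) z(2,3), of "k + l"] pow_mult_distrib[of x z "Suc (k + l)"] z(3) c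
    by (simp add: p_def r_def)
  have "y \<otimes> x = q \<otimes> (p \<otimes> (z \<otimes> x))" using yx zc by simp
  also have "\<dots> = (y \<otimes> x) \<otimes> (z \<otimes> x)" using c pqr yx by (simp add: m_assoc)
  also have "\<dots> = ((y \<otimes> x) \<otimes> p) \<otimes> r" unfolding zx using c pqr by (simp add: m_assoc)
  finally have e: "y \<otimes> x = z \<otimes> x" using ym zx by simp
  have "y = (y \<otimes> x) \<otimes> y" using m_assoc[of x y y] c y by simp
  also have "\<dots> = z \<otimes> (y \<otimes> x)" using e m_assoc[of z x y] y(3) c by simp
  also have "\<dots> = z \<otimes> (x \<otimes> z)" using e z(3) by simp
  also have "\<dots> = z" using m_assoc[of z x z] m_assoc[of x z z] c z by simp
  finally show ?thesis .
qed

lemma drazin_inverse_unique: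
  assumes "is_drazin_inverse X Y" "is_drazin_inverse X Z"
  shows "Y = Z"
proof -
  define n where "n = dim_row X"
  interpret ring "ring_mat TYPE(complex) n ()" by (rule ring_mat)
  have X: "X \<in> carrier_mat n n" using assms by (auto simp: is_drazin_inverse_def n_def)
  have Y: "Y \<in> carrier_mat n n" "X * (Y * Y) = Y" "X * Y = Y * X"
    and Z: "Z \<in> carrier_mat n n" "X * (Z * Z) = Z" "X * Z = Z * X"
    using assms unfolding is_drazin_inverse_def n_def by blast+
  obtain k l where "Y * X ^\<^sub>m Suc k = X ^\<^sub>m k" "Z * X ^\<^sub>m Suc l = X ^\<^sub>m l"
    using assms unfolding is_drazin_inverse_def Suc_eq_plus1 by blast
  note kl = this[unfolded pow_mat_ring_pow[OF X, of _ "()"]]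
  show ?thesis
    by (rule drazin_unique_aux[of X Y Z k l, unfolded ring_mat_simps, OF X Y(1) Z(1)
          kl(1) Y(2,3) kl(2) Z(2,3)])
qed

lemma group_inverse_imp_drazin_inverse:
  assumes "is_group_inverse Z Y"
  shows "is_drazin_inverse Z Y"
proof -
  define n where "n = dim_row Z"
  have Z: "square_mat Z" "Z \<in> carrier_mat n n" and Y: "Y \<in> carrier_mat n n"
    using assms unfolding is_group_inverse_def n_def by auto
  have eq: "Z * Y * Z = Z" "Y * Z * Y = Y" "Z * Y = Y * Z"
    using assms unfolding is_group_inverse_def by blast+
  have "Z ^\<^sub>m 1 = Z"
    using left_mult_one_mat[OF Z(2)] unfolding One_nat_def pow_mat.simps n_def .
  moreover from this have "Z ^\<^sub>m (1 + 1) = Z * Z"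
    by (metis Suc_eq_plus1 pow_mat.simps(2))
  moreover have "Y * (Z * Z) = Z"
    using eq(1) unfolding eq(3) assoc_mult_mat[OF Y Z(2) Z(2)] .
  ultimately have "\<exists>k. Y * Z ^\<^sub>m (k + 1) = Z ^\<^sub>m k"
    by (intro exI[of _ 1]) (simp only:)
  moreover have "Z * (Y * Y) = Y"
    using eq(2) unfolding eq(3)[symmetric] assoc_mult_mat[OF Z(2) Y Y] .
  ultimately show ?thesis
    using Z(1) Y eq(3) unfolding is_drazin_inverse_def n_def by blast
qed

lemma group_inverse_unique:
  "is_group_inverse Z Y \<Longrightarrow> is_group_inverse Z W \<Longrightarrow> Y = W"
  using group_inverse_imp_drazin_inverse drazin_inverse_unique by blast

lemma mat_adjoint_carrier:
  "P \<in> carrier_mat nr nc \<Longrightarrow> mat_adjoint P \<in> carrier_mat nc nr"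
  by (auto simp: mat_adjoint_def)

lemma mat_adjoint_index:
  "i < dim_col P \<Longrightarrow> j < dim_row P \<Longrightarrow> mat_adjoint P $$ (i, j) = cnj (P $$ (j, i))"
  by (simp add: mat_adjoint_def mat_of_rows_index)

lemma mat_adjoint_mult:
  fixes P Q :: "complex mat"
  assumes "P \<in> carrier_mat a b" "Q \<in> carrier_mat b c"
  shows "mat_adjoint (P * Q) = mat_adjoint Q * mat_adjoint P"
proof (rule eq_matI)
  have d: "dim_row P = a" "dim_col P = b" "dim_row Q = b" "dim_col Q = c" using assms by auto
  have da: "dim_row (mat_adjoint P) = b" "dim_col (mat_adjoint P) = a"
     "dim_row (mat_adjoint Q) = c" "dim_col (mat_adjoint Q) = b"
     "dim_row (mat_adjoint (P * Q)) = c" "dim_col (mat_adjoint (P * Q)) = a"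
    using d by (auto simp: mat_adjoint_def)
  show "dim_row (mat_adjoint (P * Q)) = dim_row (mat_adjoint Q * mat_adjoint P)"
    "dim_col (mat_adjoint (P * Q)) = dim_col (mat_adjoint Q * mat_adjoint P)"
    using da by auto
  fix i j assume "i < dim_row (mat_adjoint Q * mat_adjoint P)"
    "j < dim_col (mat_adjoint Q * mat_adjoint P)"
  then show "mat_adjoint (P * Q) $$ (i, j) = (mat_adjoint Q * mat_adjoint P) $$ (i, j)"
    using d da by (simp add: mat_adjoint_index scalar_prod_def mult.commute)
qed

lemma moore_penrose_inverse_unique:
  assumes "is_moore_penrose_inverse Z Y" "is_moore_penrose_inverse Z W"
  shows "Y = W"
proof -
  define a b where "a = dim_row Z" and "b = dim_col Z"
  have c: "Z \<in> carrier_mat a b" "Y \<in> carrier_mat b a" "W \<in> carrier_mat b a"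
    using assms by (auto simp: is_moore_penrose_inverse_def a_def b_def)
  have y: "Z * Y * Z = Z" "Y * Z * Y = Y" "mat_adjoint (Z * Y) = Z * Y" "mat_adjoint (Y * Z) = Y * Z"
    and w: "Z * W * Z = Z" "W * Z * W = W" "mat_adjoint (Z * W) = Z * W" "mat_adjoint (W * Z) = W * Z"
    using assms by (auto simp: is_moore_penrose_inverse_def)
  have cc: "Z * Y \<in> carrier_mat a a" "Z * W \<in> carrier_mat a a"
    "Y * Z \<in> carrier_mat b b" "W * Z \<in> carrier_mat b b"
    using c by auto
  have "Z * Y = (Z * W) * (Z * Y)"
    using w(1) assoc_mult_mat[OF cc(2) c(1,2)] by simp
  then have "Z * Y = (Z * Y) * (Z * W)"
    using y(3) w(3) mat_adjoint_mult[OF cc(2,1)] by simp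
  also have "\<dots> = Z * W"
    using y(1) assoc_mult_mat[OF cc(1) c(1,3)] by simp
  finally have l: "Z * Y = Z * W" .
  have "Y * Z = (Y * Z) * (W * Z)"
    using w(1) assoc_mult_mat[OF c(2,1) cc(4)] assoc_mult_mat[OF c(1,3,1)] by simp
  then have "Y * Z = (W * Z) * (Y * Z)"
    using y(4) w(4) mat_adjoint_mult[OF cc(3,4)] by simp
  also have "\<dots> = W * Z"
    using y(1) assoc_mult_mat[OF c(3,1) cc(3)] assoc_mult_mat[OF c(1,2,1)] by simp
  finally have r: "Y * Z = W * Z" .
  have "Y = W * (Z * Y)" using y(2) r assoc_mult_mat[OF c(3,1,2)] by simp
  also have "\<dots> = W" using l w(2) assoc_mult_mat[OF c(3,1,3)] by simp
  finally show ?thesis .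
qed

text \<open>Hence each of the three operators denotes the inverse in question whenever it exists.\<close>

lemma drazin_inverse_eqI: "is_drazin_inverse X Y \<Longrightarrow> drazin_inverse X = Y"
  unfolding drazin_inverse_def by (blast intro: the_equality drazin_inverse_unique)

lemma moore_penrose_inverse_eqI: "is_moore_penrose_inverse Z Y \<Longrightarrow> moore_penrose_inverse Z = Y"
  unfolding moore_penrose_inverse_def by (blast intro: the_equality moore_penrose_inverse_unique)

lemma group_inverse_eqI: "is_group_inverse Z Y \<Longrightarrow> group_inverse Z = Y"
  unfolding group_inverse_def by (blast intro: the_equality group_inverse_unique)

end

theory Submission
  imports Defs "HOL-Algebra.Subrings"
begin

text \<open>
  If \<open>Y\<close> is the Drazin inverse of \<open>X\<close>, then \<open>X Y\<close> is an idempotent, the projection onto the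
  range of a high power of \<open>X\<close> along its kernel. A square matrix \<open>X\<close> is *-DMP if and only if it
  has a Drazin inverse \<open>Y\<close> for which this projection is Hermitian
  (\<open>star_dmp_iff_hermitian_projection\<close>).

  Write \<open>M = S + T\<close> with \<open>S = diag (A, D)\<close> and \<open>T\<close> the off-diagonal part of \<open>M\<close>. The relations
  \<open>A B = B D\<close> and \<open>D C = C A\<close> say exactly that \<open>S T = T S\<close>. The projection of \<open>S\<close> is
  block diagonal with the projections of \<open>A\<close> and \<open>D\<close> as blocks, so it is Hermitian. Since
  \<open>T\<^sup>2 = diag (B C, C B)\<close>, and since \<open>T\<close> has the same projection as \<open>T\<^sup>2\<close>
  (\<open>drazin_of_power\<close>), the projection of \<open>T\<close> is Hermitian too. Let \<open>S\<^sup>D\<close> be the Drazin inverse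
  of \<open>S\<close>. The square of \<open>S\<^sup>D T\<close> is block diagonal, with blocks \<open>F G\<close> and \<open>G F\<close> for
  \<open>F = A\<^sup>D B\<close> and \<open>G = D\<^sup>D C\<close>. As \<open>F G\<close> is nilpotent, so are \<open>G F\<close> and \<open>S\<^sup>D T\<close>.

  What remains is a statement about rings (\<open>drazin_sum\<close>): if \<open>x\<close> and \<open>z\<close> commute, have Drazin
  inverses \<open>y\<close> and \<open>w\<close>, and \<open>y z\<close> is nilpotent, then \<open>x + z\<close> has a Drazin inverse, and its
  projection is the sum \<open>x y + z w\<close> of the two projections. Indeed all four elements commute,
  the product of the projections is zero because \<open>y z\<close> is nilpotent, on either of them \<open>x + z\<close> is
  the sum of an invertible and a commuting nilpotent element, hence invertible, and on the
  complement of both it is a sum of two commuting nilpotents. The sum of two Hermitian matrices is Hermitian, which ends the argument.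
\<close>

section \<open>Drazin inverses in monoids\<close>

text \<open>The Drazin inverse of an element of an abstract monoid; for the multiplicative monoid of a
  matrix ring this is the matrix notion, see \<open>is_drazin_inverse_iff\<close> below. Membership of both
  elements in the carrier is part of the definition.\<close>

definition is_drazin :: "('a, 'b) monoid_scheme \<Rightarrow> 'a \<Rightarrow> 'a \<Rightarrow> bool" where
  "is_drazin G x y \<longleftrightarrow> x \<in> carrier G \<and> y \<in> carrier G \<and>
     (\<exists>k::nat. y \<otimes>\<^bsub>G\<^esub> x [^]\<^bsub>G\<^esub> Suc k = x [^]\<^bsub>G\<^esub> k) \<and>
     x \<otimes>\<^bsub>G\<^esub> (y \<otimes>\<^bsub>G\<^esub> y) = y \<and> x \<otimes>\<^bsub>G\<^esub> y = y \<otimes>\<^bsub>G\<^esub> x"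

text \<open>The element \<open>x \<otimes> y\<close> is an idempotent that fixes \<open>y\<close> and all sufficiently high powers
  of \<open>x\<close>, and on which \<open>x\<close> and \<open>y\<close> are inverse to each other.\<close>

lemma (in monoid) drazin_projection:
  assumes "is_drazin G x y"
  shows "x \<in> carrier G" "y \<in> carrier G" "x \<otimes> y = y \<otimes> x" "x \<otimes> (y \<otimes> y) = y"
    and "(x \<otimes> y) \<otimes> y = y" "y \<otimes> (x \<otimes> y) = y"
    and "(x \<otimes> y) [^] Suc n = x \<otimes> y"
    and "x [^] Suc n \<otimes> y [^] Suc n = x \<otimes> y"
    and "\<exists>k::nat. (x \<otimes> y) \<otimes> x [^] k = x [^] k \<and> x [^] k \<otimes> (x \<otimes> y) = x [^] k"
proof -
  show c: "x \<in> carrier G" "y \<in> carrier G" and xy: "x \<otimes> y = y \<otimes> x" and xyy: "x \<otimes> (y \<otimes> y) = y"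
    using assms unfolding is_drazin_def by blast+
  show py: "(x \<otimes> y) \<otimes> y = y"
    using c xyy by (simp add: m_assoc)
  then show yp: "y \<otimes> (x \<otimes> y) = y"
    using c xy by (metis m_assoc)
  have "(x \<otimes> y) \<otimes> (x \<otimes> y) = x \<otimes> y"
    using c yp by (simp add: m_assoc)
  then show pn: "(x \<otimes> y) [^] Suc n = x \<otimes> y"
    using c by (induction n) (simp_all add: m_assoc)
  show "x [^] Suc n \<otimes> y [^] Suc n = x \<otimes> y"
    using pow_mult_distrib[OF xy c, of "Suc n"] pn by simp
  obtain k :: nat where k: "y \<otimes> x [^] Suc k = x [^] k"
    using assms unfolding is_drazin_def by blast
  have "(x \<otimes> y) \<otimes> x [^] k = y \<otimes> (x \<otimes> x [^] k)"
    using c xy by (simp add: m_assoc)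
  also have "x \<otimes> x [^] k = x [^] Suc k"
    using nat_pow_Suc2 c by simp
  finally have l: "(x \<otimes> y) \<otimes> x [^] k = x [^] k"
    using k by simp
  have "x \<otimes> (x \<otimes> y) = (x \<otimes> y) \<otimes> x"
    using c xy m_assoc[of x y x] by simp
  then have "x [^] k \<otimes> (x \<otimes> y) = (x \<otimes> y) \<otimes> x [^] k"
    using group_commutes_pow c by simp
  then show "\<exists>k::nat. (x \<otimes> y) \<otimes> x [^] k = x [^] k \<and> x [^] k \<otimes> (x \<otimes> y) = x [^] k"
    using l by auto
qed

lemma (in monoid) is_drazinI:
  assumes "x \<in> carrier G" "y \<in> carrier G" "x \<otimes> y = y \<otimes> x"
    and "(x \<otimes> y) \<otimes> y = y" "(x \<otimes> y) \<otimes> x [^] (k::nat) = x [^] k"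
  shows "is_drazin G x y"
proof -
  have "y \<otimes> x [^] Suc k = (x \<otimes> y) \<otimes> x [^] k"
    using assms(1-3) nat_pow_Suc2[OF assms(1), of k] m_assoc[of y x "x [^] k"] by simp
  then show ?thesis
    unfolding is_drazin_def using assms m_assoc[of x y y] by auto
qed

text \<open>The Drazin inverse lies in the bicommutant of the element.\<close>

lemma (in monoid) drazin_double_commute:
  assumes d: "is_drazin G x y" and a: "a \<in> carrier G" and ax: "a \<otimes> x = x \<otimes> a"
  shows "a \<otimes> y = y \<otimes> a"
proof -
  note D = drazin_projection[OF d]
  note c = D(1,2) a
  define p where "p = x \<otimes> y"
  have p: "p \<in> carrier G" using c by (simp add: p_def)
  obtain k :: nat where "p \<otimes> x [^] k = x [^] k" "x [^] k \<otimes> p = x [^] k"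
    using D(9) unfolding p_def by blast
  then have k: "p \<otimes> x [^] Suc k = x [^] Suc k" "x [^] Suc k \<otimes> p = x [^] Suc k"
    using c p nat_pow_Suc2[OF c(1), of k] m_assoc[of p "x [^] k" x] m_assoc[of x "x [^] k" p]
    by simp_all
  \<comment> \<open>The projection factors through a power of \<open>x\<close>, which commutes with \<open>a\<close>; sandwiching \<open>a\<close>
     between the two factors shows that \<open>a \<otimes> p\<close> and \<open>p \<otimes> a\<close> both equal \<open>p \<otimes> a \<otimes> p\<close>.\<close>
  define u v where "u = x [^] Suc k" and "v = y [^] Suc k"
  have uv: "u \<in> carrier G" "v \<in> carrier G" using c by (simp_all add: u_def v_def)
  have "x [^] Suc k \<otimes> y [^] Suc k = y [^] Suc k \<otimes> x [^] Suc k"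
    using D(3) c by (metis group_commutes_pow nat_pow_closed)
  then have puv: "p = u \<otimes> v" "p = v \<otimes> u"
    using D(8)[of k] by (simp_all add: u_def v_def p_def)
  have au: "a \<otimes> u = u \<otimes> a"
    unfolding u_def using ax c group_commutes_pow by metis
  have ku: "p \<otimes> u = u" "u \<otimes> p = u" using k by (simp_all add: u_def)
  have "a \<otimes> p = u \<otimes> a \<otimes> v"
    using puv(1) au uv c by (simp add: m_assoc[symmetric])
  also have "\<dots> = p \<otimes> (u \<otimes> a \<otimes> v)"
    using ku p uv c by (simp add: m_assoc[symmetric])
  also have "\<dots> = p \<otimes> (a \<otimes> p)"
    using puv(1) au uv c by (simp add: m_assoc[symmetric])
  finally have 1: "a \<otimes> p = p \<otimes> (a \<otimes> p)" .
  have "p \<otimes> a = v \<otimes> a \<otimes> u"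
    using puv(2) au uv c by (simp add: m_assoc)
  also have "\<dots> = (v \<otimes> a \<otimes> u) \<otimes> p"
    using ku p uv c by (simp add: m_assoc)
  also have "\<dots> = (p \<otimes> a) \<otimes> p"
    using puv(2) au uv c by (simp add: m_assoc)
  finally have ap: "a \<otimes> p = p \<otimes> a"
    using 1 p c by (simp add: m_assoc)
  have "a \<otimes> y = (a \<otimes> p) \<otimes> y"
    using D(5) c p by (simp add: m_assoc p_def)
  also have "\<dots> = y \<otimes> (x \<otimes> a) \<otimes> y"
    unfolding ap using c D(3) by (simp add: m_assoc p_def)
  also have "\<dots> = y \<otimes> (a \<otimes> p)"
    using c ax[symmetric] by (simp add: m_assoc p_def)
  also have "\<dots> = (y \<otimes> p) \<otimes> a"
    unfolding ap using c p by (simp add: m_assoc)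
  finally show ?thesis using D(6) by (simp add: p_def)
qed

text \<open>An element inherits a Drazin inverse from any of its positive powers, with the same
  projection.\<close>

lemma (in monoid) drazin_of_power:
  fixes r :: nat
  assumes x: "x \<in> carrier G" and d: "is_drazin G (x [^] Suc r) y"
  shows "is_drazin G x (x [^] r \<otimes> y)" "x \<otimes> (x [^] r \<otimes> y) = x [^] Suc r \<otimes> y"
proof -
  note nat_pow_Suc [simp del]
  note D = drazin_projection[OF d]
  have y: "y \<in> carrier G" by (rule D)
  define u where "u = x [^] r"
  have u: "u \<in> carrier G" using x by (simp add: u_def)
  have z: "x [^] Suc r = x \<otimes> u" "x [^] Suc r = u \<otimes> x"
    using x by (simp_all add: u_def nat_pow_Suc nat_pow_Suc2[symmetric])
  then have ux: "x \<otimes> u = u \<otimes> x" by simp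
  have xy: "x \<otimes> y = y \<otimes> x" and uy: "u \<otimes> y = y \<otimes> u"
    using drazin_double_commute[OF d, unfolded z(1)] x u m_assoc[of x u u] m_assoc[of u x u]
    by (simp_all add: m_assoc ux[symmetric])
  show e: "x \<otimes> (x [^] r \<otimes> y) = x [^] Suc r \<otimes> y"
    unfolding z(1) u_def[symmetric] using x u y by (simp add: m_assoc)
  obtain k :: nat where k: "(x [^] Suc r \<otimes> y) \<otimes> (x [^] Suc r) [^] k = (x [^] Suc r) [^] k"
    using D(9) by blast
  show "is_drazin G x (x [^] r \<otimes> y)"
  proof (rule is_drazinI[where k = "Suc r * k"])
    show "x \<otimes> (x [^] r \<otimes> y) = x [^] r \<otimes> y \<otimes> x"
      unfolding u_def[symmetric] using x u y
      by (simp add: m_assoc xy[symmetric]) (simp add: m_assoc[symmetric] ux)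
    have "x \<otimes> (u \<otimes> y) \<otimes> (u \<otimes> y) = x \<otimes> u \<otimes> (y \<otimes> (u \<otimes> y))"
      using x u y by (simp add: m_assoc)
    also have "\<dots> = (x \<otimes> u \<otimes> (y \<otimes> y)) \<otimes> u"
      unfolding uy using x u y by (simp add: m_assoc)
    also have "\<dots> = u \<otimes> y"
      using D(4) z uy by simp
    finally show "x \<otimes> (x [^] r \<otimes> y) \<otimes> (x [^] r \<otimes> y) = x [^] r \<otimes> y"
      unfolding u_def .
    show "x \<otimes> (x [^] r \<otimes> y) \<otimes> x [^] (Suc r * k) = x [^] (Suc r * k)"
      unfolding e using k unfolding nat_pow_pow[OF x] .
  qed (use x y in simp_all)
qed

text \<open>Conversely, some positive power of \<open>x\<close> has the corresponding power of \<open>y\<close> as its group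
  inverse, again with the same projection.\<close>

lemma (in monoid) drazin_power_group_inverse:
  assumes "is_drazin G x y"
  shows "\<exists>k::nat. x [^] Suc k \<otimes> y [^] Suc k = x \<otimes> y \<and> y [^] Suc k \<otimes> x [^] Suc k = x \<otimes> y \<and>
    (x \<otimes> y) \<otimes> x [^] Suc k = x [^] Suc k \<and> (x \<otimes> y) \<otimes> y [^] Suc k = y [^] Suc k"
proof -
  note nat_pow_Suc [simp del]
  note X = drazin_projection[OF assms]
  obtain k :: nat where k: "(x \<otimes> y) \<otimes> x [^] k = x [^] k" using X(9) by blast
  have "y [^] Suc k \<otimes> x [^] Suc k = x \<otimes> y"
    using pow_mult_distrib[OF X(3)[symmetric] X(2,1), of "Suc k"] X(7)[of k] X(3) by simp
  moreover have "(x \<otimes> y) \<otimes> x [^] Suc k = x [^] Suc k"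
    using k X(1,2) m_assoc[of "x \<otimes> y" "x [^] k" x] by (simp add: nat_pow_Suc)
  moreover have "(x \<otimes> y) \<otimes> y [^] Suc k = y [^] Suc k"
    using X(5) X(1,2) m_assoc[of "x \<otimes> y" y "y [^] k"] nat_pow_Suc2[of y k] by simp
  ultimately show ?thesis using X(8)[of k] by blast
qed

lemma (in monoid) pow_mult_rotate:
  fixes m :: nat
  assumes "a \<in> carrier G" "b \<in> carrier G"
  shows "(b \<otimes> a) [^] Suc m = b \<otimes> (a \<otimes> b) [^] m \<otimes> a"
proof (induction m)
  case (Suc m)
  then have "(b \<otimes> a) [^] Suc (Suc m) = b \<otimes> (a \<otimes> b) [^] m \<otimes> a \<otimes> (b \<otimes> a)"
    by (simp only: nat_pow_Suc)
  then show ?case using assms by (simp add: m_assoc)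
qed (use assms in simp)

section \<open>Drazin inverses of sums in commutative rings\<close>

lemma (in ring) geometric_series_inverse:
  fixes n :: nat
  assumes t: "t \<in> carrier R" and nil: "t [^] n = \<zero>"
  shows "\<exists>u\<in>carrier R. (\<one> \<oplus> t) \<otimes> u = \<one>"
proof -
  \<comment> \<open>The partial sums of the alternating geometric series; the disjunction stands for the sign
     of \<open>(- t)\<^sup>n\<close>.\<close>
  have "\<exists>u\<in>carrier R. (\<one> \<oplus> t) \<otimes> u = \<one> \<oplus> t [^] n \<or> (\<one> \<oplus> t) \<otimes> u = \<one> \<ominus> t [^] n" for n :: nat
  proof (induction n)
    case 0
    show ?case by (rule bexI[of _ \<zero>]) (use t in \<open>simp_all add: a_minus_def r_neg\<close>)
  next
    case (Suc n)
    then obtain u where u: "u \<in> carrier R"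
      "(\<one> \<oplus> t) \<otimes> u = \<one> \<oplus> t [^] n \<or> (\<one> \<oplus> t) \<otimes> u = \<one> \<ominus> t [^] n" by blast
    have "(\<one> \<oplus> t) \<otimes> (\<one> \<ominus> t \<otimes> u) = (\<one> \<oplus> t) \<ominus> t \<otimes> ((\<one> \<oplus> t) \<otimes> u)"
      using t u(1) by (simp add: l_distr r_distr a_minus_def r_minus minus_add m_assoc a_ac)
    moreover have "(\<one> \<oplus> t) \<ominus> t \<otimes> (\<one> \<oplus> s) = \<one> \<ominus> t \<otimes> s"
      "(\<one> \<oplus> t) \<ominus> t \<otimes> (\<one> \<ominus> s) = \<one> \<oplus> t \<otimes> s" if "s \<in> carrier R" for s
    proof -
      have "(\<one> \<oplus> t) \<ominus> (t \<oplus> q) = \<one> \<ominus> q" "(\<one> \<oplus> t) \<ominus> (t \<ominus> q) = \<one> \<oplus> q"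
        if "q \<in> carrier R" for q
        using t that by algebra+
      then show "(\<one> \<oplus> t) \<ominus> t \<otimes> (\<one> \<oplus> s) = \<one> \<ominus> t \<otimes> s"
        "(\<one> \<oplus> t) \<ominus> t \<otimes> (\<one> \<ominus> s) = \<one> \<oplus> t \<otimes> s"
        using t that by (simp_all add: r_distr a_minus_def r_minus)
    qed
    moreover have "t \<otimes> t [^] n = t [^] Suc n"
      using nat_pow_Suc2 t by simp
    ultimately show ?case
      using t u by (intro bexI[of _ "\<one> \<ominus> t \<otimes> u"]) auto
  qed
  from this[of n] show ?thesis using nil t by (auto simp: a_minus_def)
qed

text \<open>For \<open>e = \<one>\<close> this says that a sum of commuting nilpotents is nilpotent. With an idempotent
  \<open>e\<close> it applies to elements that are nilpotent only on the corner of \<open>e\<close>.\<close>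

lemma (in cring) nilpotent_sum_annihilates:
  fixes k l :: nat
  assumes "x \<in> carrier R" "z \<in> carrier R" "e \<in> carrier R"
    and "x [^] k \<otimes> e = \<zero>" "z [^] l \<otimes> e = \<zero>"
  shows "(x \<oplus> z) [^] (k + l) \<otimes> e = \<zero>"
  using assms
proof (induction "k + l" arbitrary: k l e)
  case 0
  then show ?case by simp
next
  case (Suc n)
  note c = Suc.prems(1-3)
  show ?case
  proof (cases "k = 0 \<or> l = 0")
    case True
    then have "e = \<zero>" using c Suc.prems(4,5) by auto
    then show ?thesis using c by simp
  next
    case False
    then obtain k' l' where kl: "k = Suc k'" "l = Suc l'" by (meson not0_implies_Suc)
    have 1: "(x \<oplus> z) [^] (k' + l) \<otimes> (x \<otimes> e) = \<zero>"
    proof (rule Suc.hyps(1))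
      have "z [^] l \<otimes> (x \<otimes> e) = x \<otimes> (z [^] l \<otimes> e)" using c by (simp add: m_lcomm)
      then show "z [^] l \<otimes> (x \<otimes> e) = \<zero>" using c Suc.prems(5) by simp
    qed (use c Suc.prems Suc.hyps(2) in \<open>simp_all add: kl m_assoc\<close>)
    have 2: "(x \<oplus> z) [^] (k + l') \<otimes> (z \<otimes> e) = \<zero>"
    proof (rule Suc.hyps(1))
      have "x [^] k \<otimes> (z \<otimes> e) = z \<otimes> (x [^] k \<otimes> e)" using c by (simp add: m_lcomm)
      then show "x [^] k \<otimes> (z \<otimes> e) = \<zero>" using c Suc.prems(4) by simp
    qed (use c Suc.prems Suc.hyps(2) in \<open>simp_all add: kl m_assoc\<close>)
    define s where "s = (x \<oplus> z) [^] (k' + l)"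
    have s: "s \<in> carrier R" "(x \<oplus> z) [^] (k + l) = s \<otimes> (x \<oplus> z)" "(x \<oplus> z) [^] (k + l') = s"
      using c by (simp_all add: s_def kl)
    have "s \<otimes> (x \<oplus> z) \<otimes> e = s \<otimes> (x \<otimes> e) \<oplus> s \<otimes> (z \<otimes> e)"
      using s(1) c by algebra
    then show ?thesis using 1 2 s by (simp add: s_def[symmetric])
  qed
qed

text \<open>The Drazin inverse of the sum is \<open>y (1 + y z)\<^sup>-\<^sup>1 + w (1 + w x)\<^sup>-\<^sup>1\<close>. The hypothesis is
  symmetric in the two summands: if \<open>y z\<close> is nilpotent, then the projections are orthogonal, and
  this makes \<open>w x\<close> nilpotent.\<close>

lemma (in cring) drazin_sum_commutative:
  assumes xy: "is_drazin R x y" and zw: "is_drazin R z w"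
    and nil: "(y \<otimes> z) [^] (m::nat) = \<zero>"
  shows "\<exists>v. is_drazin R (x \<oplus> z) v \<and> (x \<oplus> z) \<otimes> v = x \<otimes> y \<oplus> z \<otimes> w"
proof -
  note X = drazin_projection[OF xy] and Z = drazin_projection[OF zw]
  note c = X(1,2) Z(1,2)
  define p q where "p = x \<otimes> y" and "q = z \<otimes> w"
  have pq: "p \<in> carrier R" "q \<in> carrier R" using c by (simp_all add: p_def q_def)
  obtain k l :: nat where k: "p \<otimes> x [^] k = x [^] k" and l: "q \<otimes> z [^] l = z [^] l"
    using X(9) Z(9) unfolding p_def q_def by blast
  have py: "p \<otimes> y = y" and qw: "q \<otimes> w = w" using X(5) Z(5) by (simp_all add: p_def q_def)
  have "p \<otimes> q = (x \<otimes> w) \<otimes> (y \<otimes> z)"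
    unfolding p_def q_def using c by algebra
  moreover have "p \<otimes> q = (p \<otimes> q) [^] Suc m"
    using X(7)[of m] Z(7)[of m] pq nat_pow_distrib[of p q "Suc m"] by (simp add: p_def q_def)
  ultimately have "p \<otimes> q = ((x \<otimes> w) \<otimes> (y \<otimes> z)) [^] Suc m"
    by simp
  also have "\<dots> = (x \<otimes> w) [^] Suc m \<otimes> ((y \<otimes> z) [^] m \<otimes> (y \<otimes> z))"
    using c nat_pow_distrib[of "x \<otimes> w" "y \<otimes> z" "Suc m"] by simp
  also have "\<dots> = \<zero>" unfolding nil using c by simp
  finally have 0: "p \<otimes> q = \<zero>" .
  have qy: "q \<otimes> y = \<zero>"
  proof -
    have "q \<otimes> y = q \<otimes> (p \<otimes> y)" using py by simp
    also have "\<dots> = (p \<otimes> q) \<otimes> y" using c pq by algebra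
    finally show ?thesis using 0 c by simp
  qed
  have pw: "p \<otimes> w = \<zero>"
  proof -
    have "p \<otimes> w = p \<otimes> (q \<otimes> w)" using qw by simp
    also have "\<dots> = (p \<otimes> q) \<otimes> w" using c pq by algebra
    finally show ?thesis using 0 c by simp
  qed
  have qx: "q \<otimes> x [^] k = \<zero>"
  proof -
    have "q \<otimes> x [^] k = q \<otimes> (p \<otimes> x [^] k)" using k by simp
    also have "\<dots> = (p \<otimes> q) \<otimes> x [^] k" using c pq by (simp add: m_assoc m_lcomm)
    finally show ?thesis using 0 c by simp
  qed
  have pz: "p \<otimes> z [^] l = \<zero>"
  proof -
    have "p \<otimes> z [^] l = p \<otimes> (q \<otimes> z [^] l)" using l by simp
    also have "\<dots> = (p \<otimes> q) \<otimes> z [^] l" using c pq by (simp add: m_assoc)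
    finally show ?thesis using 0 c by simp
  qed
  have "(w \<otimes> x) [^] Suc k = (q \<otimes> w) [^] Suc k \<otimes> x [^] Suc k"
    using c qw nat_pow_distrib[of w x "Suc k"] by simp
  also have "\<dots> = q [^] k \<otimes> w [^] Suc k \<otimes> ((q \<otimes> x [^] k) \<otimes> x)"
    using c pq nat_pow_distrib[of q w "Suc k"] by (simp add: m_ac)
  also have "\<dots> = \<zero>" unfolding qx using c pq by simp
  finally have nil': "(w \<otimes> x) [^] Suc k = \<zero>" .
  obtain u u' where u: "u \<in> carrier R" "(\<one> \<oplus> y \<otimes> z) \<otimes> u = \<one>"
    and u': "u' \<in> carrier R" "(\<one> \<oplus> w \<otimes> x) \<otimes> u' = \<one>"
    using geometric_series_inverse[OF _ nil] geometric_series_inverse[OF _ nil'] c by auto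
  define v where "v = y \<otimes> u \<oplus> w \<otimes> u'"
  have v: "v \<in> carrier R" "x \<oplus> z \<in> carrier R" using c u u' by (simp_all add: v_def)
  have "(x \<oplus> z) \<otimes> y = p \<oplus> (p \<otimes> y) \<otimes> z"
    unfolding py unfolding p_def using c by algebra
  also have "\<dots> = p \<otimes> (\<one> \<oplus> y \<otimes> z)" using c pq by algebra
  finally have 1: "(x \<oplus> z) \<otimes> y \<otimes> u = p"
    using u c pq by (simp add: m_assoc)
  have "(x \<oplus> z) \<otimes> w = q \<oplus> (q \<otimes> w) \<otimes> x"
    unfolding qw unfolding q_def using c by algebra
  also have "\<dots> = q \<otimes> (\<one> \<oplus> w \<otimes> x)" using c pq by algebra
  finally have 2: "(x \<oplus> z) \<otimes> w \<otimes> u' = q"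
    using u' c pq by (simp add: m_assoc)
  have xv: "(x \<oplus> z) \<otimes> v = p \<oplus> q"
    unfolding v_def using 1 2 c u(1) u'(1) by (simp add: r_distr m_assoc)
  have "(p \<oplus> q) \<otimes> v = (p \<otimes> y \<oplus> q \<otimes> y) \<otimes> u \<oplus> (p \<otimes> w \<oplus> q \<otimes> w) \<otimes> u'"
    unfolding v_def using c pq u(1) u'(1) by algebra
  then have pv: "(p \<oplus> q) \<otimes> v = v"
    using py qy pw qw c u u' by (simp add: v_def)
  \<comment> \<open>On the complement \<open>\<one> \<ominus> (p \<oplus> q)\<close> both summands are nilpotent.\<close>
  have ann: "a \<otimes> (\<one> \<ominus> (p \<oplus> q)) = a \<ominus> (p \<otimes> a \<oplus> q \<otimes> a)" if "a \<in> carrier R" for a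
    using that pq by algebra
  have "(x \<oplus> z) [^] (k + l) \<otimes> (\<one> \<ominus> (p \<oplus> q)) = \<zero>"
    by (rule nilpotent_sum_annihilates)
      (use c pq k l pz qx in \<open>simp_all add: ann[unfolded a_minus_def] a_minus_def r_neg\<close>)
  then have "(x \<oplus> z) [^] (k + l) = (p \<oplus> q) \<otimes> (x \<oplus> z) [^] (k + l)"
    using v pq ann[of "(x \<oplus> z) [^] (k + l)"] by (simp add: l_distr)
  then have "is_drazin R (x \<oplus> z) v"
    by (intro is_drazinI[where k = "k + l"]) (use v xv pv m_comm in simp_all)
  then show ?thesis using xv by (auto simp: p_def q_def)
qed

section \<open>Passage to the bicommutant\<close>

text \<open>The elements of the carrier that commute with every element of \<open>K\<close>.\<close>

definition centralizer :: "('a, 'b) monoid_scheme \<Rightarrow> 'a set \<Rightarrow> 'a set" where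
  "centralizer G K = {a \<in> carrier G. \<forall>k\<in>K. a \<otimes>\<^bsub>G\<^esub> k = k \<otimes>\<^bsub>G\<^esub> a}"

lemma (in ring) centralizer_subring:
  assumes "K \<subseteq> carrier R"
  shows "subring (centralizer R K) R"
proof (rule subringI)
  fix a b assume "a \<in> centralizer R K" "b \<in> centralizer R K"
  then have a: "a \<in> carrier R" "\<And>k. k \<in> K \<Longrightarrow> a \<otimes> k = k \<otimes> a"
    and b: "b \<in> carrier R" "\<And>k. k \<in> K \<Longrightarrow> b \<otimes> k = k \<otimes> b"
    by (auto simp: centralizer_def)
  have "a \<otimes> b \<otimes> k = k \<otimes> (a \<otimes> b)" if "k \<in> K" for k
  proof -
    have k: "k \<in> carrier R" using that assms by blast
    have "a \<otimes> b \<otimes> k = (a \<otimes> k) \<otimes> b" using a(1) b k that by (simp add: m_assoc)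
    also have "\<dots> = k \<otimes> (a \<otimes> b)" using a b(1) k that by (simp add: m_assoc)
    finally show ?thesis .
  qed
  then show "a \<otimes> b \<in> centralizer R K" using a b by (auto simp: centralizer_def)
  show "a \<oplus> b \<in> centralizer R K"
    using a b assms by (auto simp: centralizer_def l_distr r_distr subset_eq)
  show "\<ominus> a \<in> centralizer R K"
    using a assms by (auto simp: centralizer_def l_minus r_minus subset_eq)
qed (use assms in \<open>auto simp: centralizer_def\<close>)

text \<open>The bicommutant of a set of pairwise commuting elements is a commutative subring.\<close>

lemma (in ring) bicommutant_subcring:
  assumes K: "K \<subseteq> carrier R" and comm: "K \<subseteq> centralizer R K"
  shows "subcring (centralizer R (centralizer R K)) R"
proof (rule subcringI)
  show "subring (centralizer R (centralizer R K)) R"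
    by (rule centralizer_subring) (auto simp: centralizer_def)
  fix a b assume a: "a \<in> centralizer R (centralizer R K)" and b: "b \<in> centralizer R (centralizer R K)"
  have "b \<in> centralizer R K" using b comm by (auto simp: centralizer_def)
  then show "a \<otimes> b = b \<otimes> a" using a by (auto simp: centralizer_def)
qed

text \<open>The elements \<open>x\<close> and \<open>z\<close> and their Drazin inverses all lie in the bicommutant of
  \<open>{x, z}\<close>, to which the commutative case applies.\<close>

lemma (in ring) drazin_sum:
  assumes xy: "is_drazin R x y" and zw: "is_drazin R z w" and xz: "x \<otimes> z = z \<otimes> x"
    and nil: "(y \<otimes> z) [^] (m::nat) = \<zero>"
  shows "\<exists>v. is_drazin R (x \<oplus> z) v \<and> (x \<oplus> z) \<otimes> v = x \<otimes> y \<oplus> z \<otimes> w"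
proof -
  define H where "H = centralizer R (centralizer R {x, z})"
  note X = drazin_projection[OF xy] and Z = drazin_projection[OF zw]
  have "subcring H R"
    unfolding H_def by (rule bicommutant_subcring) (use X Z xz in \<open>auto simp: centralizer_def\<close>)
  moreover have HR: "H \<subseteq> carrier R" by (auto simp: H_def centralizer_def)
  ultimately interpret H: cring "R\<lparr>carrier := H\<rparr>" using subcring_iff by blast
  have H: "x \<in> H" "z \<in> H" "y \<in> H" "w \<in> H"
    using X(1,2) Z(1,2) drazin_double_commute[OF xy] drazin_double_commute[OF zw]
    by (auto simp: H_def centralizer_def)
  have iff: "is_drazin (R\<lparr>carrier := H\<rparr>) a b \<longleftrightarrow> is_drazin R a b" if "a \<in> H" "b \<in> H" for a b
    using that HR unfolding is_drazin_def by (auto simp: nat_pow_consistent[symmetric])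
  obtain v where v: "is_drazin (R\<lparr>carrier := H\<rparr>) (x \<oplus> z) v" "(x \<oplus> z) \<otimes> v = x \<otimes> y \<oplus> z \<otimes> w"
    using H.drazin_sum_commutative[of x y z w m] xy zw nil H iff
    by (auto simp: nat_pow_consistent[symmetric])
  then have "x \<oplus> z \<in> H" "v \<in> H" unfolding is_drazin_def by simp_all
  then show ?thesis using v iff by blast
qed

section \<open>Matrices with Hermitian Drazin projection\<close>

lemma is_drazin_inverse_iff:
  assumes "X \<in> carrier_mat n n"
  shows "is_drazin_inverse X Y \<longleftrightarrow> is_drazin (ring_mat TYPE(complex) n ()) X Y"
  using assms unfolding is_drazin_inverse_def is_drazin_def
  by (auto simp: ring_mat_simps pow_mat_ring_pow[OF assms, of _ "()", symmetric]
      simp del: pow_mat.simps Group.nat_pow_Suc)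

text \<open>If the Moore-Penrose inverse and the group inverse of a power \<open>Z\<close> of \<open>X\<close> agree, then their
  common value \<open>W\<close> is a Drazin inverse of \<open>Z\<close>, and its projection \<open>Z W\<close>, which is also that of
  \<open>X\<close>, is Hermitian by the Moore-Penrose equations. Conversely, when the projection is Hermitian,
  the group inverse of a suitable power satisfies those equations.\<close>

lemma star_dmp_iff_hermitian_projection:
  assumes X: "X \<in> carrier_mat n n"
  shows "star_dmp X \<longleftrightarrow> (\<exists>Y. is_drazin_inverse X Y \<and> mat_adjoint (X * Y) = X * Y)"
proof
  interpret ring "ring_mat TYPE(complex) n ()" by (rule ring_mat)
  note R = ring_mat_simps[where 'a = complex and n = n and b = "()"]
    pow_mat_ring_pow[OF _, of _ n _ "()", symmetric]
  {
    assume "star_dmp X"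
    then obtain r Y where r: "r > 0" and mp: "is_moore_penrose_inverse (X ^\<^sub>m r) Y"
      and g: "is_group_inverse (X ^\<^sub>m r) Y"
      unfolding star_dmp_def by (metis group_inverse_eqI moore_penrose_inverse_eqI)
    obtain s where s: "r = Suc s" using r by (cases r) auto
    have "is_drazin_inverse (X ^\<^sub>m Suc s) Y"
      using group_inverse_imp_drazin_inverse[OF g] s by simp
    then have "is_drazin (ring_mat TYPE(complex) n ()) (X [^]\<^bsub>ring_mat TYPE(complex) n ()\<^esub> Suc s) Y"
      unfolding pow_mat_ring_pow[OF X, of _ "()", symmetric]
        is_drazin_inverse_iff[OF pow_carrier_mat[OF X], symmetric] .
    from drazin_of_power[OF _ this] obtain W
      where "is_drazin (ring_mat TYPE(complex) n ()) X W" "X * W = X ^\<^sub>m r * Y"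
      using X unfolding R(1,5) s pow_mat_ring_pow[OF X, of _ "()"] by blast
    then show "\<exists>Y. is_drazin_inverse X Y \<and> mat_adjoint (X * Y) = X * Y"
      using mp X unfolding is_moore_penrose_inverse_def is_drazin_inverse_iff[OF X] by auto
  next
    assume "\<exists>Y. is_drazin_inverse X Y \<and> mat_adjoint (X * Y) = X * Y"
    then obtain Y where d: "is_drazin (ring_mat TYPE(complex) n ()) X Y"
      and h: "mat_adjoint (X * Y) = X * Y"
      unfolding is_drazin_inverse_iff[OF X] by blast
    have Y: "Y \<in> carrier_mat n n" using d by (simp add: is_drazin_def R)
    obtain k where k: "X ^\<^sub>m Suc k * Y ^\<^sub>m Suc k = X * Y" "Y ^\<^sub>m Suc k * X ^\<^sub>m Suc k = X * Y"
      "(X * Y) * X ^\<^sub>m Suc k = X ^\<^sub>m Suc k" "(X * Y) * Y ^\<^sub>m Suc k = Y ^\<^sub>m Suc k"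
      using drazin_power_group_inverse[OF d]
      unfolding pow_mat_ring_pow[OF X, of _ "()"] pow_mat_ring_pow[OF Y, of _ "()"] R(1) by blast
    define Z W where "Z = X ^\<^sub>m Suc k" and "W = Y ^\<^sub>m Suc k"
    have c: "Z \<in> carrier_mat n n" "W \<in> carrier_mat n n"
      using X Y by (simp_all add: Z_def W_def del: pow_mat.simps)
    note k = k[folded Z_def W_def]
    have g: "is_group_inverse Z W" and m: "is_moore_penrose_inverse Z W"
      using c k h unfolding is_group_inverse_def is_moore_penrose_inverse_def by auto
    show "star_dmp X"
      unfolding star_dmp_def
      using X g m group_inverse_eqI[OF g] moore_penrose_inverse_eqI[OF m]
      by (intro conjI exI[of _ "Suc k"]) (auto simp: Z_def simp del: pow_mat.simps)
  }
qed

section \<open>Block matrices\<close>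

text \<open>The block diagonal matrix with blocks \<open>X\<close> of size \<open>n\<close> and \<open>Y\<close> of size \<open>m\<close>.\<close>

abbreviation block_diag :: "nat \<Rightarrow> nat \<Rightarrow> complex mat \<Rightarrow> complex mat \<Rightarrow> complex mat" where
  "block_diag n m X Y \<equiv> four_block_mat X (0\<^sub>m n m) (0\<^sub>m m n) Y"

lemma block_diag_mult:
  assumes "X \<in> carrier_mat n n" "Y \<in> carrier_mat m m" "Z \<in> carrier_mat n n" "W \<in> carrier_mat m m"
  shows "block_diag n m X Y * block_diag n m Z W = block_diag n m (X * Z) (Y * W)"
  by (subst mult_four_block_mat) (use assms in auto)

lemma mat_adjoint_add:
  fixes P Q :: "complex mat"
  assumes "P \<in> carrier_mat a b" "Q \<in> carrier_mat a b"
  shows "mat_adjoint (P + Q) = mat_adjoint P + mat_adjoint Q"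
  by (rule eq_matI)
    (use assms mat_adjoint_carrier[of P a b] mat_adjoint_carrier[of Q a b]
       mat_adjoint_carrier[of "P + Q" a b] in \<open>auto simp: mat_adjoint_index\<close>)

lemma block_diag_hermitian:
  assumes "P \<in> carrier_mat n n" "Q \<in> carrier_mat m m" "mat_adjoint P = P" "mat_adjoint Q = Q"
  shows "mat_adjoint (block_diag n m P Q) = block_diag n m P Q"
proof (rule eq_matI)
  have P: "cnj (P $$ (j, i)) = P $$ (i, j)" if "i < n" "j < n" for i j
    using mat_adjoint_index[of i P j] assms that by auto
  have Q: "cnj (Q $$ (j, i)) = Q $$ (i, j)" if "i < m" "j < m" for i j
    using mat_adjoint_index[of i Q j] assms that by auto
  show "mat_adjoint (block_diag n m P Q) $$ (i, j) = block_diag n m P Q $$ (i, j)"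
    if "i < dim_row (block_diag n m P Q)" "j < dim_col (block_diag n m P Q)" for i j
    using assms(1,2) that by (auto simp: mat_adjoint_index P Q)
qed (use mat_adjoint_carrier[of "block_diag n m P Q" "n + m" "n + m"] assms in auto)

lemma block_diag_drazin:
  assumes X: "X \<in> carrier_mat n n" and Y: "Y \<in> carrier_mat m m"
    and "is_drazin_inverse X X'" "is_drazin_inverse Y Y'"
  shows "is_drazin_inverse (block_diag n m X Y) (block_diag n m X' Y')"
proof -
  have XY: "block_diag n m X Y \<in> carrier_mat (n + m) (n + m)" using X Y by simp
  have c: "X' \<in> carrier_mat n n" "Y' \<in> carrier_mat m m"
    and comm: "X * X' = X' * X" "Y * Y' = Y' * Y"
    and outer: "X * (X' * X') = X'" "Y * (Y' * Y') = Y'"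
    using assms unfolding is_drazin_inverse_def by auto
  \<comment> \<open>The two blocks may have different indices; every exponent above the index works, so that
     the sum of the two serves both.\<close>
  have absorb: "\<exists>k. \<forall>j. (Z * Z') * Z ^\<^sub>m (k + j) = Z ^\<^sub>m (k + j)"
    if Z: "Z \<in> carrier_mat d d" and inv: "is_drazin_inverse Z Z'" for d Z Z'
  proof -
    interpret ring "ring_mat TYPE(complex) d ()" by (rule ring_mat)
    note D = drazin_projection[OF inv[unfolded is_drazin_inverse_iff[OF Z]]]
    obtain k :: nat where "(Z * Z') * Z ^\<^sub>m k = Z ^\<^sub>m k"
      using D(9) unfolding pow_mat_ring_pow[OF Z, of _ "()"] ring_mat_simps by blast
    moreover have "Z ^\<^sub>m (k + j) = Z ^\<^sub>m k * Z ^\<^sub>m j" for j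
      using nat_pow_mult[of Z k j] Z
      unfolding pow_mat_ring_pow[OF Z, of _ "()"] ring_mat_simps by simp
    moreover have "Z' \<in> carrier_mat d d" using D(2) by (simp add: ring_mat_simps)
    ultimately show ?thesis
      using Z assoc_mult_mat[of "Z * Z'" d d "Z ^\<^sub>m k" d "Z ^\<^sub>m _" d]
      by (intro exI[of _ k]) (simp del: pow_mat.simps)
  qed
  obtain k l where "\<And>j. (X * X') * X ^\<^sub>m (k + j) = X ^\<^sub>m (k + j)"
    "\<And>j. (Y * Y') * Y ^\<^sub>m (l + j) = Y ^\<^sub>m (l + j)"
    using absorb[OF X assms(3)] absorb[OF Y assms(4)] by blast
  from this(1)[of l] this(2)[of k]
  have kl: "(X * X') * X ^\<^sub>m (k + l) = X ^\<^sub>m (k + l)" "(Y * Y') * Y ^\<^sub>m (k + l) = Y ^\<^sub>m (k + l)"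
    unfolding add.commute[of l k] .
  interpret ring "ring_mat TYPE(complex) (n + m) ()" by (rule ring_mat)
  have "is_drazin (ring_mat TYPE(complex) (n + m) ()) (block_diag n m X Y) (block_diag n m X' Y')"
  proof (rule is_drazinI[where x = "block_diag n m X Y" and k = "k + l",
        folded pow_mat_ring_pow[OF XY], unfolded ring_mat_simps])
    show "block_diag n m X Y * block_diag n m X' Y' * block_diag n m X' Y' = block_diag n m X' Y'"
      using X Y c outer by (simp add: block_diag_mult)
    show "block_diag n m X Y * block_diag n m X' Y' * block_diag n m X Y ^\<^sub>m (k + l) = block_diag n m X Y ^\<^sub>m (k + l)"
      using X Y c kl by (simp add: block_diag_mult pow_four_block_mat del: pow_mat.simps)
  qed (use X Y c comm in \<open>simp_all add: block_diag_mult\<close>)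
  then show ?thesis unfolding is_drazin_inverse_iff[OF XY] .
qed

section \<open>The *-DMP property of the block matrix\<close>

theorem theorem4p2:
  fixes A B C D :: "complex mat" and n :: nat
  assumes "A \<in> carrier_mat n n" and "B \<in> carrier_mat n n"
    and "C \<in> carrier_mat n n" and "D \<in> carrier_mat n n"
    and "star_dmp A" and "star_dmp D" and "star_dmp (B * C)" and "star_dmp (C * B)"
    and "A * B = B * D" and "D * C = C * A"
    and "mat_adjoint A * B = B * mat_adjoint D"
    and "mat_adjoint D * C = C * mat_adjoint A"
    and "nilpotent_mat (drazin_inverse A * B * drazin_inverse D * C)"
  shows "star_dmp (four_block_mat A B C D)"
proof -
  note c = assms(1-4)
  let ?R = "ring_mat TYPE(complex) (n + n) ()"
  let ?R1 = "ring_mat TYPE(complex) n ()"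
  interpret R: ring ?R by (rule ring_mat)
  interpret R1: ring ?R1 by (rule ring_mat)
  have bc: "B * C \<in> carrier_mat n n" "C * B \<in> carrier_mat n n" using c by auto
  obtain A' where A': "is_drazin_inverse A A'" "mat_adjoint (A * A') = A * A'"
    using star_dmp_iff_hermitian_projection[OF c(1)] assms(5) by blast
  obtain D' where D': "is_drazin_inverse D D'" "mat_adjoint (D * D') = D * D'"
    using star_dmp_iff_hermitian_projection[OF c(4)] assms(6) by blast
  obtain U where U: "is_drazin_inverse (B * C) U" "mat_adjoint (B * C * U) = B * C * U"
    using star_dmp_iff_hermitian_projection[OF bc(1)] assms(7) by blast
  obtain V where V: "is_drazin_inverse (C * B) V" "mat_adjoint (C * B * V) = C * B * V"
    using star_dmp_iff_hermitian_projection[OF bc(2)] assms(8) by blast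
  have c': "A' \<in> carrier_mat n n" "D' \<in> carrier_mat n n" "U \<in> carrier_mat n n" "V \<in> carrier_mat n n"
    using A' D' U V c unfolding is_drazin_inverse_def by auto
  define S where "S = block_diag n n A D"
  define T where "T = four_block_mat (0\<^sub>m n n) B C (0\<^sub>m n n)"
  define S' where "S' = block_diag n n A' D'"
  define W where "W = block_diag n n U V"
  have C: "S \<in> carrier_mat (n + n) (n + n)" "T \<in> carrier_mat (n + n) (n + n)"
    "S' \<in> carrier_mat (n + n) (n + n)" "W \<in> carrier_mat (n + n) (n + n)"
    using c c' by (simp_all add: S_def T_def S'_def W_def)
  have "S * T = four_block_mat (0\<^sub>m n n) (A * B) (D * C) (0\<^sub>m n n)"
    unfolding S_def T_def by (subst mult_four_block_mat) (use c in auto)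
  moreover have "T * S = four_block_mat (0\<^sub>m n n) (B * D) (C * A) (0\<^sub>m n n)"
    unfolding S_def T_def by (subst mult_four_block_mat) (use c in auto)
  ultimately have ST: "S * T = T * S" using assms(9,10) by simp
  have T2: "T ^\<^sub>m Suc 1 = block_diag n n (B * C) (C * B)"
  proof -
    have "T ^\<^sub>m Suc 1 = T * T" using C(2) by (simp add: T_def)
    also have "\<dots> = block_diag n n (B * C) (C * B)"
      unfolding T_def by (subst mult_four_block_mat) (use c in auto)
    finally show ?thesis .
  qed
  have dS: "is_drazin ?R S S'"
    unfolding is_drazin_inverse_iff[OF C(1), symmetric] unfolding S_def S'_def
    by (rule block_diag_drazin[OF c(1,4) A'(1) D'(1)])
  have "is_drazin_inverse (T ^\<^sub>m Suc 1) W"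
    unfolding T2 W_def by (rule block_diag_drazin[OF bc U(1) V(1)])
  then have dT2: "is_drazin ?R (T [^]\<^bsub>?R\<^esub> Suc 1) W"
    unfolding pow_mat_ring_pow[OF C(2), of _ "()", symmetric]
      is_drazin_inverse_iff[OF pow_carrier_mat[OF C(2)], symmetric] .
  obtain T' where dT: "is_drazin ?R T T'" and TT': "T * T' = T ^\<^sub>m Suc 1 * W"
    using R.drazin_of_power[OF _ dT2] C(2)
    unfolding pow_mat_ring_pow[OF C(2), of _ "()"] ring_mat_simps by blast
  have SS: "S * S' = block_diag n n (A * A') (D * D')"
    unfolding S_def S'_def using c c' by (simp add: block_diag_mult)
  have TT: "T * T' = block_diag n n (B * C * U) (C * B * V)"
    unfolding TT' T2 W_def using bc c' by (simp add: block_diag_mult)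
  have hS: "mat_adjoint (S * S') = S * S'"
    unfolding SS by (rule block_diag_hermitian) (use c c' A' D' in auto)
  have hT: "mat_adjoint (T * T') = T * T'"
    unfolding TT by (rule block_diag_hermitian) (use bc c' U V in auto)
  have nil: "\<exists>m::nat. (S' * T) [^]\<^bsub>?R\<^esub> m = 0\<^sub>m (n + n) (n + n)"
  proof -
    define F G where "F = A' * B" and "G = D' * C"
    have FG: "F \<in> carrier_mat n n" "G \<in> carrier_mat n n" using c c' by (simp_all add: F_def G_def)
    have fg: "F * G \<in> carrier_mat n n" "G * F \<in> carrier_mat n n" using FG by auto
    have "drazin_inverse A * B * drazin_inverse D * C = F * G"
      unfolding drazin_inverse_eqI[OF A'(1)] drazin_inverse_eqI[OF D'(1)] F_def G_def
      using c c' by (simp add: assoc_mult_mat[of _ n n _ n _ n])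
    then obtain m where m: "(F * G) ^\<^sub>m m = 0\<^sub>m n n"
      using assms(13) FG unfolding nilpotent_mat_def by auto
    have "(F * G) ^\<^sub>m Suc m = 0\<^sub>m n n"
      using m left_mult_zero_mat[OF fg(1)] by simp
    moreover have "(G * F) ^\<^sub>m Suc m = G * (F * G) ^\<^sub>m m * F"
      using R1.pow_mult_rotate[of F G m] FG
      unfolding pow_mat_ring_pow[OF fg(1), of _ "()"] pow_mat_ring_pow[OF fg(2), of _ "()"] ring_mat_simps
      by blast
    ultimately have z: "(F * G) ^\<^sub>m Suc m = 0\<^sub>m n n" "(G * F) ^\<^sub>m Suc m = 0\<^sub>m n n"
      using m FG by simp_all
    have E: "S' * T = four_block_mat (0\<^sub>m n n) F G (0\<^sub>m n n)"
      unfolding S'_def T_def F_def G_def by (subst mult_four_block_mat) (use c c' in auto)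
    then have EE: "(S' * T) * (S' * T) = block_diag n n (F * G) (G * F)"
      unfolding E by (subst mult_four_block_mat) (use FG in auto)
    have c2: "S' * T \<in> carrier_mat (n + n) (n + n)" "(S' * T) * (S' * T) \<in> carrier_mat (n + n) (n + n)"
      using C by auto
    have "(S' * T) [^]\<^bsub>?R\<^esub> (2 * Suc m) = ((S' * T) [^]\<^bsub>?R\<^esub> (2::nat)) [^]\<^bsub>?R\<^esub> Suc m"
      using R.nat_pow_pow[of "S' * T" 2 "Suc m"] c2 by (simp add: ring_mat_simps)
    also have "(S' * T) [^]\<^bsub>?R\<^esub> (2::nat) = (S' * T) * (S' * T)"
      using c2 R.nat_pow_Suc[of "S' * T" 1] R.nat_pow_eone[of "S' * T"]
      by (simp add: ring_mat_simps numeral_2_eq_2)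
    also have "\<dots> [^]\<^bsub>?R\<^esub> Suc m = ((S' * T) * (S' * T)) ^\<^sub>m Suc m"
      by (rule pow_mat_ring_pow[OF c2(2), symmetric])
    also have "\<dots> = 0\<^sub>m (n + n) (n + n)"
      unfolding EE pow_four_block_mat[OF fg] z by simp
    finally show ?thesis by blast
  qed
  obtain X where "is_drazin ?R (S + T) X" "(S + T) * X = S * S' + T * T'"
    using R.drazin_sum[OF dS dT] ST nil unfolding ring_mat_simps by blast
  moreover have "mat_adjoint (S * S' + T * T') = S * S' + T * T'"
    using mat_adjoint_add[of "S * S'" "n + n" "n + n" "T * T'"] hS hT C R.drazin_projection(2)[OF dT]
    by (simp add: ring_mat_simps)
  ultimately have "star_dmp (S + T)"
    using C star_dmp_iff_hermitian_projection[of "S + T" "n + n"] is_drazin_inverse_iff[of "S + T" "n + n"]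
    by auto
  moreover have "S + T = four_block_mat A B C D"
    unfolding S_def T_def by (subst add_four_block_mat) (use c in auto)
  ultimately show ?thesis by simp
qed

end
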